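(* Let $n\ge 4$ and $\ell>0$. For $i=1,2$ let $r_i\ge 1$, $s_i\ge 1$ be integers with $r_i+s_i=n$, let $\mathsf G_i=\mathsf{FB}_{r_i,s_i}$ be the corresponding fuzzy ball, and assume $r_1\ne r_2$. Let $\mathcal G_i$ be the equilateral metric graph with underlying combinatorial graph $\mathsf G_i$, each of whose edges has length $\ell$, with real-valued potentials $q_{\mathsf e}\in L^2(0,\ell)$ on its edges $\mathsf e$. Attach one lead (half-infinite edge) to either of the off-bulk vertices of $\mathsf G_1$, and one lead to either of the off-bulk vertices of $\mathsf G_2$, and let the potential be $q_0=0$ on each of the attached leads. Then the two graphs yield different functions $\hat\phi_D$, and the co-spectral metric graphs $\mathcal G_1,\mathcal G_2$ can thus be distinguished.
   Context: Fuzzy ball $\mathsf{FB}_{r,s}$: the combinatorial graph on $r+s+2$ vertices obtained from the complete graph $K_n$ (the bulk) on $n=r+s$ vertices $\mathsf v_1,\dots,\mathsf v_n$ by adding two vertices $\mathsf w_1,\mathsf w_2$ (the off-bulk vertices), where $\mathsf w_1$ is adjacent to $\mathsf v_1,\dots,\mathsf v_r$ and $\mathsf w_2$ is adjacent to $\mathsf v_{r+1},\dots,\mathsf v_{r+s}$. For fixed $n$, all graphs $\mathsf{FB}_{r,s}$ with $r+s=n$ have the same number of vertices and edges and are co-spectral with respect to the normalized Laplacian; the corresponding equilateral metric graphs with zero potentials and standard vertex conditions (continuity and Kirchhoff) are co-spectral too. The function $\hat\phi_D$: for an equilateral metric graph $\mathcal G$ with $V$ vertices, $E$ edges of length $\ell$,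 and a set $\mathsf V^*$ of distinguished vertices (here the single vertex at which the lead is attached), the Dirichlet problem on the compact graph $\mathcal G$ consists of $-y_{\mathsf e}''+q_{\mathsf e}y_{\mathsf e}=\lambda y_{\mathsf e}$ on each edge, with continuity and Kirchhoff conditions at all vertices outside $\mathsf V^*$ and $y=0$ at the vertices of $\mathsf V^*$. Its characteristic function $\phi_D$ is the determinant (determined up to a constant multiple) of the linear system obtained by inserting the general solution on the edges into the vertex conditions; its zeros are the eigenvalues. The leading term $\hat\phi_D$ is this characteristic function in the case of identically zero potentials on all edges, which is given by $$\hat\phi_D(\lambda)=\left(\frac{\sin\sqrt\lambda\,\ell}{\sqrt\lambda}\right)^{E-V+\#\mathsf V^*}P(\cos\sqrt\lambda\,\ell),\qquad P(z)=\det\bigl(z\hat D-\hat A\bigr),$$ where $\hat A$ is the adjacency matrix of the graph obtained by deleting $\mathsf V^*$ and all edges incident to it, and $\hat D$ is the diagonal matrix of the degrees, in the original graph, of the vertices not in $\mathsf V^*$.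
   Formalization: The formal theorem excludes the case r_1 = s_2 with the leads at differently labelled off-bulk vertices (w_1 of one, w_2 of the other); there the two graphs with leads are isomorphic and the functions agree up to a constant. "Different" means not constant multiples of each other. *)

theory Defs
  imports "HOL-Analysis.Analysis" "Jordan_Normal_Form.Determinant"
begin

(* Equilateral metric graphs over a finite simple graph with vertices in nat.  Every edge {u, v} is
   present as the two arcs (u, v) and (v, u), so that arc (u, v) stands for the end at u of that
   edge.  For u < v the edge is identified with the interval {0..len}, with u at 0 and v at len, and
   its potential is pot (u, v) (pot (v, u) is never used). *)
record metric_graph =
  verts :: "nat set"
  arcs :: "(nat \<times> nat) set"
  len :: real
  pot :: "nat \<times> nat \<Rightarrow> real \<Rightarrow> real"

(* A metric graph with one half-infinite edge, carrying the potential lead_pot u, attached at each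
   vertex u of lead_verts. *)
record lead_graph = metric_graph +
  lead_verts :: "nat set"
  lead_pot :: "nat \<Rightarrow> real \<Rightarrow> real"

definition attach_lead :: "metric_graph \<Rightarrow> nat \<Rightarrow> (real \<Rightarrow> real) \<Rightarrow> lead_graph" where
  "attach_lead G u q0 =
     metric_graph.extend G (lead_graph.fields {u} ((\<lambda>_ _. 0)(u := q0)))"

definition L2_potential :: "real \<Rightarrow> (real \<Rightarrow> real) \<Rightarrow> bool" where
  "L2_potential l q \<longleftrightarrow>
     set_borel_measurable lebesgue {0<..<l} q \<and> set_integrable lebesgue {0<..<l} (\<lambda>x. (q x)\<^sup>2)"

(* y solves -y'' + q y = z y on {0..l} and y1 = y'.  As q need not be continuous, the equation is
   integrated once: y' is absolutely continuous and y'' = (q - z) y almost everywhere. *)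
definition sl_solution ::
  "real \<Rightarrow> (real \<Rightarrow> real) \<Rightarrow> complex \<Rightarrow> (real \<Rightarrow> complex) \<Rightarrow> (real \<Rightarrow> complex) \<Rightarrow> bool" where
  "sl_solution l q z y y1 \<longleftrightarrow>
     (\<forall>x\<in>{0..l}. (y has_vector_derivative y1 x) (at x within {0..l}) \<and>
        ((\<lambda>t. (complex_of_real (q t) - z) * y t) has_integral (y1 x - y1 0)) {0..x})"

(* The pair (y l, y' l) for the unique solution with y 0 = a, y' 0 = b. *)
definition sl_end ::
  "real \<Rightarrow> (real \<Rightarrow> real) \<Rightarrow> complex \<Rightarrow> complex \<Rightarrow> complex \<Rightarrow> complex \<times> complex" where
  "sl_end l q z a b =
     (THE w. \<exists>y y1. sl_solution l q z y y1 \<and> y 0 = a \<and> y1 0 = b \<and> w = (y l, y1 l))"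

(* The general solution on the edge {u, v}, u < v, is A c + B s, where c, s are the solutions with
   c 0 = 1, c' 0 = 0, s 0 = 0, s' 0 = 1.  The unknowns of the linear system are the coefficients of
   all edges, stored as A = k (u, v) and B = k (v, u).  The functions below give the value, and the
   derivative in the direction away from the vertex, of this solution at the end described by an
   arc. *)
definition end_value ::
  "'a metric_graph_scheme \<Rightarrow> complex \<Rightarrow> (nat \<times> nat \<Rightarrow> complex) \<Rightarrow> nat \<times> nat \<Rightarrow> complex"
  where
  "end_value G z k = (\<lambda>(u, v).
     if u < v then k (u, v)
     else k (v, u) * fst (sl_end (len G) (pot G (v, u)) z 1 0)
        + k (u, v) * fst (sl_end (len G) (pot G (v, u)) z 0 1))"

definition end_deriv ::
  "'a metric_graph_scheme \<Rightarrow> complex \<Rightarrow> (nat \<times> nat \<Rightarrow> complex) \<Rightarrow> nat \<times> nat \<Rightarrow> complex"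
  where
  "end_deriv G z k = (\<lambda>(u, v).
     if u < v then k (v, u)
     else - (k (v, u) * snd (sl_end (len G) (pot G (v, u)) z 1 0)
           + k (u, v) * snd (sl_end (len G) (pot G (v, u)) z 0 1)))"

definition pivot :: "'a metric_graph_scheme \<Rightarrow> nat \<Rightarrow> nat" where
  "pivot G u = (LEAST v. (u, v) \<in> arcs G)"

(* Left-hand sides of the homogeneous vertex conditions of the Dirichlet problem, one for each arc.
   A lead vertex u has the condition y = 0 on each incident edge.  A vertex u of degree d without a
   lead has d - 1 continuity conditions, each comparing an incident edge with the edge to pivot u,
   and the Kirchhoff condition, which is filed under the arc (u, pivot u). *)
definition vertex_condition ::
  "lead_graph \<Rightarrow> complex \<Rightarrow> (nat \<times> nat \<Rightarrow> complex) \<Rightarrow> nat \<times> nat \<Rightarrow> complex" where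
  "vertex_condition G z k = (\<lambda>(u, v).
     if u \<in> lead_verts G then end_value G z k (u, v)
     else if v \<noteq> pivot G u then end_value G z k (u, v) - end_value G z k (u, pivot G u)
     else (\<Sum>w | w \<in> verts G \<and> (u, w) \<in> arcs G. end_deriv G z k (u, w)))"

definition arc_list :: "'a metric_graph_scheme \<Rightarrow> (nat \<times> nat) list" where
  "arc_list G = filter (\<lambda>a. a \<in> arcs G)
     (List.product (sorted_list_of_set (verts G)) (sorted_list_of_set (verts G)))"

(* Characteristic function of the Dirichlet problem: determinant of the system of vertex conditions
   in the coefficients k (entry (i, j) is the coefficient of the j-th unknown in the i-th condition).
   Reordering conditions or unknowns, or scaling them, changes it by a nonzero constant factor. *)
definition phi_D :: "lead_graph \<Rightarrow> complex \<Rightarrow> complex" where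
  "phi_D G z =
     (let as = arc_list G; N = length as in
      Determinant.det (Matrix.mat N N
        (\<lambda>(i, j). vertex_condition G z (\<lambda>a. if a = as ! j then 1 else 0) (as ! i))))"

(* Zero potentials on all edges.  For a connected graph with at least one edge this equals, up to
   sign, (sin (sqrt z * len) / sqrt z) ^ (E - V + #V* ) * P (cos (sqrt z * len)). *)
definition phi_D_hat :: "lead_graph \<Rightarrow> complex \<Rightarrow> complex" where
  "phi_D_hat G = phi_D (G\<lparr>pot := (\<lambda>_ _. 0)\<rparr>)"

definition equal_up_to_constant :: "(complex \<Rightarrow> complex) \<Rightarrow> (complex \<Rightarrow> complex) \<Rightarrow> bool" where
  "equal_up_to_constant f g \<longleftrightarrow> (\<exists>c. c \<noteq> 0 \<and> (\<forall>z. f z = c * g z))"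

(* With n = r + s, the bulk vertices are 1, ..., n, and n + 1 and n + 2 are the off-bulk vertices w_1
   and w_2.  Each edge occurs here once, directed from the smaller to the larger vertex. *)
definition fuzzy_ball_edges :: "nat \<Rightarrow> nat \<Rightarrow> (nat \<times> nat) set" where
  "fuzzy_ball_edges r s =
     {(i, j). 1 \<le> i \<and> i < j \<and> j \<le> r + s} \<union>
     {1..r} \<times> {r + s + 1} \<union> {r + 1..r + s} \<times> {r + s + 2}"

(* fuzzy_ball r s and fuzzy_ball s r are isomorphic by a map that exchanges the two off-bulk vertices,
   so leads at r + s + 1 in the former and r + s + 2 in the latter give isomorphic lead graphs. *)
definition off_bulk :: "nat \<Rightarrow> nat set" where
  "off_bulk n = {n + 1, n + 2}"

definition fuzzy_ball ::
  "nat \<Rightarrow> nat \<Rightarrow> real \<Rightarrow> (nat \<times> nat \<Rightarrow> real \<Rightarrow> real) \<Rightarrow> metric_graph" where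
  "fuzzy_ball r s l q =
     \<lparr>verts = {1..r + s + 2}, arcs = fuzzy_ball_edges r s \<union> (fuzzy_ball_edges r s)\<inverse>,
      len = l, pot = q\<rparr>"

end

(* The zeros already separate the two functions. Where sin (sqrt z * len) is nonzero, a solution of
   the zero-potential Dirichlet problem is determined by its vertex values f, and the Kirchhoff
   conditions become sum_{w ~ u} f w = deg u * x * f u with x = cos (sqrt z * len). On a fuzzy ball,
   if n x + 1 is nonzero, f is constant on the neighbours of each off-bulk vertex, and a nonzero
   solution exists iff x is a root of an explicit cubic. The cubics for two degrees of the lead
   vertex differ by a nonzero constant, so they have no common root; and each cubic has a root in
   (-1, 1) other than -1/n. *)
theory Submission
  imports Defs
begin

section \<open>Solutions on an edge with zero potential\<close>

lemma sl_solution_zero_potentialI: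
  assumes "l \<ge> 0" "\<mu> \<noteq> 0"
  shows "sl_solution l (\<lambda>_. 0) (complex_of_real (\<mu>\<^sup>2))
      (\<lambda>t. a * complex_of_real (cos (\<mu> * t)) + b * complex_of_real (sin (\<mu> * t) / \<mu>))
      (\<lambda>t. - a * complex_of_real (\<mu> * sin (\<mu> * t)) + b * complex_of_real (cos (\<mu> * t)))"
    (is "sl_solution l _ _ ?y ?y1")
proof -
  have dy: "(?y has_vector_derivative ?y1 t) (at t within X)" for t X
    using \<open>\<mu> \<noteq> 0\<close>
    by (auto intro!: derivative_eq_intros simp: has_vector_derivative_def fun_eq_iff scaleR_conv_of_real algebra_simps)
  have dy1: "(?y1 has_vector_derivative (complex_of_real 0 - complex_of_real (\<mu>\<^sup>2)) * ?y t) (at t within X)" for t X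
    using \<open>\<mu> \<noteq> 0\<close>
    by (auto intro!: derivative_eq_intros simp: has_vector_derivative_def fun_eq_iff scaleR_conv_of_real field_simps power2_eq_square)
  show ?thesis
    unfolding sl_solution_def
  proof (intro ballI conjI dy)
    fix x assume "x \<in> {0..l}"
    then show "((\<lambda>t. (complex_of_real 0 - complex_of_real (\<mu>\<^sup>2)) * ?y t) has_integral ?y1 x - ?y1 0) {0..x}"
      by (intro fundamental_theorem_of_calculus dy1) auto
  qed
qed

text \<open>Turning the vector \<open>(\<mu> * y t, y1 t)\<close> through the angle
  \<open>\<mu> * t\<close> gives a constant vector, so the data at 0 determine the data at
  \<open>l\<close>. This is the uniqueness behind \<open>sl_end\<close>.\<close>

lemma sl_solution_zero_potentialD:
  assumes "sl_solution l (\<lambda>_. 0) (complex_of_real (\<mu>\<^sup>2)) y y1" "l > 0" "\<mu> \<noteq> 0"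
  shows "y l = y 0 * complex_of_real (cos (\<mu> * l)) + y1 0 * complex_of_real (sin (\<mu> * l) / \<mu>)"
    and "y1 l = - y 0 * complex_of_real (\<mu> * sin (\<mu> * l)) + y1 0 * complex_of_real (cos (\<mu> * l))"
proof -
  let ?z = "complex_of_real (\<mu>\<^sup>2)"
  have dy: "(y has_vector_derivative y1 x) (at x within {0..l})" if "x \<in> {0..l}" for x
    using assms(1) that by (auto simp: sl_solution_def)
  have int: "((\<lambda>t. - ?z * y t) has_integral (y1 x - y1 0)) {0..x}" if "x \<in> {0..l}" for x
    using assms(1) that by (auto simp: sl_solution_def)
  have "continuous_on {0..l} y"
    using dy by (meson continuous_on_eq_continuous_within has_vector_derivative_continuous)
  then have cont: "continuous_on {0..l} (\<lambda>t. - ?z * y t)"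
    by (intro continuous_intros)
  \<comment> \<open>The equation is given in integrated form. Its integrand is continuous because
    \<open>y\<close> is, so \<open>y1\<close> is differentiable at every point.\<close>
  have dy1: "(y1 has_vector_derivative - ?z * y x) (at x within {0..l})" if x: "x \<in> {0..l}" for x
  proof -
    have "((\<lambda>u. integral {0..u} (\<lambda>t. - ?z * y t) + y1 0) has_vector_derivative - ?z * y x + 0) (at x within {0..l})"
      by (intro has_vector_derivative_add integral_has_vector_derivative cont x has_vector_derivative_const)
    moreover have "integral {0..u} (\<lambda>t. - ?z * y t) + y1 0 = y1 u" if "u \<in> {0..l}" for u
      using integral_unique[OF int[OF that]] by simp
    ultimately show ?thesis
      by (metis (no_types, lifting) add.right_neutral has_vector_derivative_transform x)
  qed
  let ?c = "\<lambda>t. complex_of_real (cos (\<mu> * t))" and ?s = "\<lambda>t. complex_of_real (sin (\<mu> * t))"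
  have dc: "(?c has_vector_derivative - complex_of_real \<mu> * ?s x) (at x within X)"
    and ds: "(?s has_vector_derivative complex_of_real \<mu> * ?c x) (at x within X)" for x X
    by (auto intro!: derivative_eq_intros simp: has_vector_derivative_def fun_eq_iff scaleR_conv_of_real)
  \<comment> \<open>The two coordinates of the rotated vector are shown to be constant;
    \<open>C\<close> and \<open>D\<close> are their values.\<close>
  have "((\<lambda>t. \<mu> * (y t * ?c t) - y1 t * ?s t) has_vector_derivative 0) (at x within {0..l})"
    if "x \<in> {0..l}" for x
    using has_vector_derivative_diff[OF
        has_vector_derivative_mult_right[OF has_vector_derivative_mult[OF dy[OF that] dc], of "complex_of_real \<mu>"]
        has_vector_derivative_mult[OF dy1[OF that] ds]]
    by (simp add: algebra_simps power2_eq_square)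
  then obtain C where C: "\<And>t. t \<in> {0..l} \<Longrightarrow> \<mu> * (y t * ?c t) - y1 t * ?s t = C"
    using has_vector_derivative_zero_constant[of "{0..l}"] by (metis (no_types, lifting) convex_real_interval(5))
  have "((\<lambda>t. \<mu> * (y t * ?s t) + y1 t * ?c t) has_vector_derivative 0) (at x within {0..l})"
    if "x \<in> {0..l}" for x
    using has_vector_derivative_add[OF
        has_vector_derivative_mult_right[OF has_vector_derivative_mult[OF dy[OF that] ds], of "complex_of_real \<mu>"]
        has_vector_derivative_mult[OF dy1[OF that] dc]]
    by (simp add: algebra_simps power2_eq_square)
  then obtain D where D: "\<And>t. t \<in> {0..l} \<Longrightarrow> \<mu> * (y t * ?s t) + y1 t * ?c t = D"
    using has_vector_derivative_zero_constant[of "{0..l}"] by (metis (no_types, lifting) convex_real_interval(5))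
  have "C = \<mu> * y 0" "D = y1 0"
    using C[of 0] D[of 0] \<open>l > 0\<close> by auto
  then have CD: "\<mu> * (y l * ?c l) - y1 l * ?s l = \<mu> * y 0" "\<mu> * (y l * ?s l) + y1 l * ?c l = y1 0"
    using C[of l] D[of l] \<open>l > 0\<close> by auto
  \<comment> \<open>Inverting the rotation: this identity collapses the squares left after combining
    both equations of \<open>CD\<close>.\<close>
  have "(?c l)\<^sup>2 + (?s l)\<^sup>2 = 1"
    by (metis add.commute of_real_1 of_real_add of_real_power sin_cos_squared_add)
  from arg_cong[OF this, of "\<lambda>e. \<mu> * y l * e"] arg_cong[OF this, of "\<lambda>e. y1 l * e"]
  have "\<mu> * y l = (\<mu> * y 0) * ?c l + y1 0 * ?s l" and "y1 l = - (\<mu> * y 0) * ?s l + y1 0 * ?c l"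
    unfolding CD[symmetric] by (simp_all add: algebra_simps power2_eq_square)
  then show "y l = y 0 * complex_of_real (cos (\<mu> * l)) + y1 0 * complex_of_real (sin (\<mu> * l) / \<mu>)"
    and "y1 l = - y 0 * complex_of_real (\<mu> * sin (\<mu> * l)) + y1 0 * complex_of_real (cos (\<mu> * l))"
    using \<open>\<mu> \<noteq> 0\<close> by (auto simp: field_simps)
qed

text \<open>\<open>sl_end\<close> is a definite description, so both halves are required: the
  explicit solution exists, and every solution with the same initial data ends in the same
  pair.\<close>

lemma sl_end_zero_potential:
  assumes "l > 0" "\<mu> \<noteq> 0"
  shows "sl_end l (\<lambda>_. 0) (complex_of_real (\<mu>\<^sup>2)) a b =
    (a * complex_of_real (cos (\<mu> * l)) + b * complex_of_real (sin (\<mu> * l) / \<mu>),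
     - a * complex_of_real (\<mu> * sin (\<mu> * l)) + b * complex_of_real (cos (\<mu> * l)))"
  unfolding sl_end_def
proof (rule the_equality)
  show "\<exists>y y1. sl_solution l (\<lambda>_. 0) (complex_of_real (\<mu>\<^sup>2)) y y1 \<and> y 0 = a \<and> y1 0 = b \<and>
      (a * complex_of_real (cos (\<mu> * l)) + b * complex_of_real (sin (\<mu> * l) / \<mu>),
       - a * complex_of_real (\<mu> * sin (\<mu> * l)) + b * complex_of_real (cos (\<mu> * l))) = (y l, y1 l)"
    using sl_solution_zero_potentialI[of l \<mu> a b] assms by (intro exI conjI) (assumption | simp)+
qed (use sl_solution_zero_potentialD assms in blast)

section \<open>Zeros of the characteristic function\<close>

lemma end_value_sum:
  "end_value G z (\<lambda>b. \<Sum>j\<in>J. c j * k j b) a = (\<Sum>j\<in>J. c j * end_value G z (k j) a)"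
  by (cases a)
    (simp add: end_value_def sum_distrib_right ring_distribs mult.assoc flip: sum.distrib)

lemma end_deriv_sum:
  "end_deriv G z (\<lambda>b. \<Sum>j\<in>J. c j * k j b) a = (\<Sum>j\<in>J. c j * end_deriv G z (k j) a)"
  by (cases a)
    (simp add: end_deriv_def sum_distrib_right algebra_simps sum_negf sum.distrib sum_subtractf)

text \<open>The matrix entries are conditions at unit coefficient functions. Linearity turns a
  matrix row times a vector into the condition at an arbitrary coefficient function.\<close>

lemma vertex_condition_sum:
  "vertex_condition G z (\<lambda>b. \<Sum>j\<in>J. c j * k j b) a = (\<Sum>j\<in>J. c j * vertex_condition G z (k j) a)"
proof (cases a)
  case (Pair u v)
  have "(\<Sum>w\<in>W. \<Sum>j\<in>J. c j * end_deriv G z (k j) (u, w)) = (\<Sum>j\<in>J. c j * (\<Sum>w\<in>W. end_deriv G z (k j) (u, w)))"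
    for W by (subst sum.swap) (simp add: sum_distrib_left)
  with Pair show ?thesis
    by (simp add: vertex_condition_def end_value_sum end_deriv_sum right_diff_distrib sum_subtractf)
qed

text \<open>A square matrix is singular iff its kernel is nontrivial, and vectors indexed by
  positions in \<open>arc_list G\<close> correspond to coefficient functions that vanish off the
  arcs.\<close>

lemma phi_D_eq_0_iff:
  assumes "finite (verts G)" "arcs G \<subseteq> verts G \<times> verts G"
  shows "phi_D G z = 0 \<longleftrightarrow>
    (\<exists>k. k \<noteq> (\<lambda>_. 0) \<and> (\<forall>a. a \<notin> arcs G \<longrightarrow> k a = 0) \<and> (\<forall>a\<in>arcs G. vertex_condition G z k a = 0))"
    (is "_ \<longleftrightarrow> ?rhs")
proof -
  define as where "as = arc_list G"
  define N where "N = length as"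
  define M where "M = Matrix.mat N N
    (\<lambda>(i, j). vertex_condition G z (\<lambda>a. if a = as ! j then 1 else 0) (as ! i))"
  \<comment> \<open>Entry \<open>j\<close> of \<open>v\<close> is placed at the arc
    \<open>as ! j\<close>. The form as a combination of unit functions is the one that
    \<open>vertex_condition_sum\<close> expects.\<close>
  define K where "K v = (\<lambda>a. \<Sum>j<N. vec_index v j * (if a = as ! j then 1 else (0::complex)))" for v
  have set_as: "set as = arcs G" and "distinct as"
    using assms by (auto simp: as_def arc_list_def distinct_product)
  have arcs_iff: "a \<in> arcs G \<longleftrightarrow> (\<exists>i<N. a = as ! i)" for a
    by (metis N_def in_set_conv_nth set_as)
  have K_nth: "K v (as ! i) = vec_index v i" if "i < N" for v i
  proof -
    have "K v (as ! i) = (\<Sum>j<N. if i = j then vec_index v j else 0)"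
      unfolding K_def using that \<open>distinct as\<close>
      by (intro sum.cong) (auto simp: N_def nth_eq_iff_index_eq)
    with that show ?thesis by simp
  qed
  have K_off: "K v a = 0" if "a \<notin> arcs G" for v a
    using that unfolding K_def by (intro sum.neutral) (auto simp: arcs_iff)
  have M: "M \<in> carrier_mat N N"
    by (simp add: M_def)
  have prod: "vec_index (M *\<^sub>v v) i = vertex_condition G z (K v) (as ! i)"
    if "v \<in> carrier_vec N" "i < N" for v i
    using that unfolding K_def vertex_condition_sum
    by (auto simp: M_def scalar_prod_def lessThan_atLeast0 mult.commute intro!: sum.cong)
  have ker: "M *\<^sub>v v = 0\<^sub>v N \<longleftrightarrow> (\<forall>a\<in>arcs G. vertex_condition G z (K v) a = 0)"
    if v: "v \<in> carrier_vec N" for v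
  proof -
    have "M *\<^sub>v v = 0\<^sub>v N \<longleftrightarrow> (\<forall>i<N. vec_index (M *\<^sub>v v) i = 0)"
      using M by (auto simp: vec_eq_iff)
    also have "\<dots> \<longleftrightarrow> (\<forall>i<N. vertex_condition G z (K v) (as ! i) = 0)"
      by (simp add: prod[OF v] del: index_mult_mat_vec)
    finally show ?thesis
      using arcs_iff by metis
  qed
  have "phi_D G z = Determinant.det M"
    by (simp add: phi_D_def Let_def M_def N_def as_def)
  then have "phi_D G z = 0 \<longleftrightarrow> (\<exists>v. v \<in> carrier_vec N \<and> v \<noteq> 0\<^sub>v N \<and> M *\<^sub>v v = 0\<^sub>v N)"
    by (simp add: det_0_iff_vec_prod_zero_field[OF M])
  also have "\<dots> \<longleftrightarrow> ?rhs"
  proof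
    assume "\<exists>v. v \<in> carrier_vec N \<and> v \<noteq> 0\<^sub>v N \<and> M *\<^sub>v v = 0\<^sub>v N"
    then obtain v where v: "v \<in> carrier_vec N" "v \<noteq> 0\<^sub>v N" "M *\<^sub>v v = 0\<^sub>v N" by blast
    then obtain i where "i < N" "vec_index v i \<noteq> 0"
      by (auto simp: vec_eq_iff)
    then have "K v \<noteq> (\<lambda>_. 0)"
      by (metis K_nth)
    with v K_off ker show ?rhs by blast
  next
    assume ?rhs
    then obtain k where k: "k \<noteq> (\<lambda>_. 0)" "\<And>a. a \<notin> arcs G \<Longrightarrow> k a = 0"
      "\<And>a. a \<in> arcs G \<Longrightarrow> vertex_condition G z k a = 0" by blast
    \<comment> \<open>Reading \<open>k\<close> off along the list of arcs inverts \<open>K\<close>;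
      since \<open>k\<close> vanishes elsewhere, \<open>v\<close> inherits its being
      nonzero.\<close>
    define v where "v = Matrix.vec N (\<lambda>j. k (as ! j))"
    have "K v a = k a" for a
      using K_nth K_off k(2) by (cases "a \<in> arcs G") (auto simp: arcs_iff v_def)
    then have "K v = k" by blast
    moreover have "v \<in> carrier_vec N" by (simp add: v_def)
    moreover have "v \<noteq> 0\<^sub>v N"
      using \<open>K v = k\<close> k(1) by (auto simp: K_def fun_eq_iff)
    ultimately show "\<exists>v. v \<in> carrier_vec N \<and> v \<noteq> 0\<^sub>v N \<and> M *\<^sub>v v = 0\<^sub>v N"
      using k(3) ker by blast
  qed
  finally show ?thesis .
qed

text \<open>Continuity gives one value \<open>f u\<close> per vertex. As \<open>sin \<theta>\<close>
  is nonzero, the two end values of an edge determine the solution on it and hence its end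
  derivatives, so Kirchhoff's condition becomes an equation in \<open>f\<close> alone.\<close>

lemma phi_D_zero_potential_eq_0_iff:
  fixes G :: lead_graph and \<theta> :: real
  assumes fin: "finite (verts G)" and arcs_sub: "arcs G \<subseteq> verts G \<times> verts G"
    and sym: "\<And>u v. (u, v) \<in> arcs G \<Longrightarrow> (v, u) \<in> arcs G"
    and irrefl: "\<And>u. (u, u) \<notin> arcs G"
    and nbr: "\<And>u. u \<in> verts G \<Longrightarrow> \<exists>v. (u, v) \<in> arcs G"
    and pot: "pot G = (\<lambda>_ _. 0)" and len: "len G > 0" and sin: "sin \<theta> \<noteq> 0"
  shows "phi_D G (complex_of_real ((\<theta> / len G)\<^sup>2)) = 0 \<longleftrightarrow>
    (\<exists>f :: nat \<Rightarrow> complex. (\<exists>u\<in>verts G. f u \<noteq> 0) \<and> (\<forall>u\<in>verts G \<inter> lead_verts G. f u = 0) \<and>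
      (\<forall>u\<in>verts G - lead_verts G.
        (\<Sum>w | w \<in> verts G \<and> (u, w) \<in> arcs G. f w) =
        of_nat (card {w \<in> verts G. (u, w) \<in> arcs G}) * complex_of_real (cos \<theta>) * f u))"
    (is "phi_D G ?z = 0 \<longleftrightarrow> ?rhs")
proof -
  define z where "z = ?z"
  define \<mu> where "\<mu> = complex_of_real (\<theta> / len G)"
  define c where "c = complex_of_real (cos \<theta>)"
  define s where "s = complex_of_real (sin \<theta>)"
  have nz: "\<mu> \<noteq> 0" "s \<noteq> 0"
    using len sin by (auto simp: \<mu>_def s_def)
  have cs: "c\<^sup>2 + s\<^sup>2 = 1"
    unfolding c_def s_def by (metis add.commute of_real_1 of_real_add of_real_power sin_cos_squared_add)
  have sl_end: "sl_end (len G) (\<lambda>_. 0) z a b = (a * c + b * s / \<mu>, - a * \<mu> * s + b * c)" for a b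
    using len nz sl_end_zero_potential[of "len G" "\<theta> / len G" a b]
    by (auto simp: c_def s_def \<mu>_def z_def)
  let ?V = "end_value G z" and ?D = "end_deriv G z"
  have V: "?V k (u, v) = (if u < v then k (u, v) else k (v, u) * c + k (u, v) * s / \<mu>)"
    and D: "?D k (u, v) = (if u < v then k (v, u) else k (v, u) * \<mu> * s - k (u, v) * c)" for k u v
    by (simp_all add: end_value_def end_deriv_def pot sl_end)
  \<comment> \<open>The outward derivative at \<open>u\<close> in terms of the two end values. It is
    the same formula for both orientations of the edge, so later steps need not distinguish
    them.\<close>
  have D_V: "?D k (u, v) * s = \<mu> * (?V k (v, u) - c * ?V k (u, v))" if "u \<noteq> v" for k u v
  proof (cases "u < v")
    case True
    with nz show ?thesis
      by (simp add: V D field_simps)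
  next
    case False
    with that have "v < u" by simp
    then have \<mu>V: "\<mu> * ?V k (u, v) = \<mu> * k (v, u) * c + k (u, v) * s"
      using nz by (simp add: V field_simps)
    have "?D k (u, v) * s = \<mu> * k (v, u) - c * (\<mu> * ?V k (u, v))"
      using arg_cong[OF cs, of "\<lambda>e. \<mu> * k (v, u) * e"] \<open>v < u\<close>
      unfolding \<mu>V by (simp add: D algebra_simps power2_eq_square)
    with \<open>v < u\<close> show ?thesis
      by (simp add: V[of _ v u] algebra_simps)
  qed
  have kirchhoff: "(\<Sum>w | w \<in> verts G \<and> (u, w) \<in> arcs G. ?D k (u, w)) = 0 \<longleftrightarrow>
      (\<Sum>w | w \<in> verts G \<and> (u, w) \<in> arcs G. f w) = of_nat (card {w \<in> verts G. (u, w) \<in> arcs G}) * c * f u"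
    if f: "\<And>u v. (u, v) \<in> arcs G \<Longrightarrow> ?V k (u, v) = f u" for k f u
  proof -
    let ?N = "{w. w \<in> verts G \<and> (u, w) \<in> arcs G}"
    have "(\<Sum>w\<in>?N. ?D k (u, w)) * s = (\<Sum>w\<in>?N. \<mu> * (f w - c * f u))"
      unfolding sum_distrib_right
    proof (rule sum.cong)
      fix w assume "w \<in> ?N"
      then have "(u, w) \<in> arcs G" "(w, u) \<in> arcs G" "u \<noteq> w"
        using sym irrefl by auto
      then show "?D k (u, w) * s = \<mu> * (f w - c * f u)"
        by (simp add: D_V f)
    qed simp
    also have "\<dots> = \<mu> * ((\<Sum>w\<in>?N. f w) - of_nat (card ?N) * c * f u)"
      by (simp add: sum_subtractf flip: sum_distrib_left)
    finally show ?thesis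
      using nz by (metis (no_types, lifting) eq_iff_diff_eq_0 mult_eq_0_iff)
  qed
  have pivot: "(u, pivot G u) \<in> arcs G" if "(u, v) \<in> arcs G" for u v
    using that unfolding pivot_def by (rule LeastI)
  show ?thesis
    unfolding z_def[symmetric] phi_D_eq_0_iff[OF fin arcs_sub]
  proof
    assume "\<exists>k. k \<noteq> (\<lambda>_. 0) \<and> (\<forall>a. a \<notin> arcs G \<longrightarrow> k a = 0) \<and>
      (\<forall>a\<in>arcs G. vertex_condition G z k a = 0)"
    then obtain k where k: "k \<noteq> (\<lambda>_. 0)" "\<And>a. a \<notin> arcs G \<Longrightarrow> k a = 0"
      "\<And>a. a \<in> arcs G \<Longrightarrow> vertex_condition G z k a = 0" by blast
    \<comment> \<open>The continuity conditions compare every end at \<open>u\<close> with the end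
      towards the pivot, so that end supplies the vertex value.\<close>
    define f where "f u = ?V k (u, pivot G u)" for u
    have f0: "f u = 0" if "u \<in> verts G" "u \<in> lead_verts G" for u
      using nbr[OF that(1)] k(3) pivot that unfolding f_def vertex_condition_def by fastforce
    have f: "?V k (u, v) = f u" if a: "(u, v) \<in> arcs G" for u v
    proof (cases "u \<in> lead_verts G")
      case True
      then show ?thesis
        using k(3)[OF a] f0[of u] a arcs_sub by (auto simp: vertex_condition_def)
    next
      case False
      then show ?thesis
        using k(3)[OF a] by (cases "v = pivot G u") (auto simp: vertex_condition_def f_def)
    qed
    have "\<exists>u\<in>verts G. f u \<noteq> 0"
    proof (rule ccontr)
      assume f_zero: "\<not> (\<exists>u\<in>verts G. f u \<noteq> 0)"
      have V0: "?V k (u, v) = 0" if "(u, v) \<in> arcs G" for u v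
        using f_zero f[OF that] that arcs_sub by auto
      \<comment> \<open>Vanishing at the 0 end removes the cosine coefficient; vanishing at the
        other end then removes the sine coefficient, because \<open>s\<close> is nonzero.\<close>
      have "k (u, v) = 0" if a: "(u, v) \<in> arcs G" for u v
      proof -
        have "u \<noteq> v" using a irrefl by auto
        with V0[OF a] V0[OF sym[OF a]] nz show ?thesis
          by (auto simp: V split: if_splits)
      qed
      with k(1,2) show False by force
    qed
    moreover have "(\<Sum>w | w \<in> verts G \<and> (u, w) \<in> arcs G. f w) =
        of_nat (card {w \<in> verts G. (u, w) \<in> arcs G}) * c * f u" if "u \<in> verts G - lead_verts G" for u
    proof -
      from that nbr pivot have "(u, pivot G u) \<in> arcs G" by blast
      from k(3)[OF this] that show ?thesis
        by (subst kirchhoff[OF f, symmetric]) (auto simp: vertex_condition_def)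
    qed
    ultimately show ?rhs
      using f0 unfolding c_def by blast
  next
    assume ?rhs
    then obtain f where f: "\<exists>u\<in>verts G. f u \<noteq> 0" "\<And>u. u \<in> verts G \<inter> lead_verts G \<Longrightarrow> f u = 0"
      "\<And>u. u \<in> verts G - lead_verts G \<Longrightarrow> (\<Sum>w | w \<in> verts G \<and> (u, w) \<in> arcs G. f w) =
        of_nat (card {w \<in> verts G. (u, w) \<in> arcs G}) * c * f u"
      unfolding c_def by blast
    \<comment> \<open>On an arc from the smaller vertex, \<open>k\<close> is the value at 0. On the
      reverse arc it is the derivative at 0, chosen by \<open>D_V\<close> so that the solution
      reaches the value \<open>f u\<close> at the far end.\<close>
    define k where "k = (\<lambda>(u, v). if (u, v) \<notin> arcs G then 0
      else if u < v then f u else \<mu> * (f u - c * f v) / s)"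
    have Vk: "?V k (u, v) = f u" if "(u, v) \<in> arcs G" for u v
      using that sym[OF that] irrefl[of u] nz by (cases u v rule: linorder_cases) (auto simp: V k_def)
    have "k \<noteq> (\<lambda>_. 0)"
    proof
      assume "k = (\<lambda>_. 0)"
      then have "f u = 0" if "(u, v) \<in> arcs G" for u v
        using Vk[OF that, symmetric] by (simp add: V \<open>k = (\<lambda>_. 0)\<close>)
      with f(1) nbr show False by blast
    qed
    moreover have "vertex_condition G z k (u, v) = 0" if a: "(u, v) \<in> arcs G" for u v
    proof -
      have u: "u \<in> verts G" using a arcs_sub by auto
      show ?thesis
        using f(2)[of u] f(3)[of u] kirchhoff[of k f u, OF Vk] u Vk[OF a] Vk[OF pivot[OF a]]
        by (auto simp: vertex_condition_def)
    qed
    ultimately show "\<exists>k. k \<noteq> (\<lambda>_. 0) \<and> (\<forall>a. a \<notin> arcs G \<longrightarrow> k a = 0) \<and>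
      (\<forall>a\<in>arcs G. vertex_condition G z k a = 0)"
      by (intro exI[of _ k]) (auto simp: k_def)
  qed
qed

section \<open>Fuzzy balls\<close>

lemma fuzzy_ball_neighbours:
  fixes r s l q
  defines "n \<equiv> r + s" and "G \<equiv> fuzzy_ball r s l q"
  shows "1 \<le> u \<Longrightarrow> u \<le> r \<Longrightarrow> {w \<in> verts G. (u, w) \<in> arcs G} = insert (n + 1) ({1..n} - {u})"
    and "r + 1 \<le> u \<Longrightarrow> u \<le> n \<Longrightarrow> {w \<in> verts G. (u, w) \<in> arcs G} = insert (n + 2) ({1..n} - {u})"
    and "{w \<in> verts G. (n + 1, w) \<in> arcs G} = {1..r}"
    and "{w \<in> verts G. (n + 2, w) \<in> arcs G} = {r + 1..n}"
  by (auto simp: n_def G_def fuzzy_ball_def fuzzy_ball_edges_def)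

text \<open>Vertices are named by their role relative to the lead vertex \<open>p\<close>:
  \<open>w\<close> is the other off-bulk vertex, \<open>S\<close> and \<open>T\<close> are the bulk
  vertices attached to \<open>p\<close> and \<open>w\<close>. Both positions of the lead are then
  treated at once.\<close>

lemma fuzzy_ball_neighbours_off_bulk:
  fixes r s l q
  defines "n \<equiv> r + s" and "G \<equiv> fuzzy_ball r s l q"
  assumes "p \<in> off_bulk n"
  obtains w S T where
    "verts G = insert p (insert w (S \<union> T))" "p \<noteq> w" "p \<notin> S \<union> T" "w \<notin> S \<union> T"
    "finite S" "finite T" "S \<inter> T = {}"
    "card T = (if p = n + 1 then s else r)" "card S = (if p = n + 1 then r else s)"
    "\<And>u. u \<in> S \<Longrightarrow> {v \<in> verts G. (u, v) \<in> arcs G} = insert p (S \<union> T - {u})"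
    "\<And>u. u \<in> T \<Longrightarrow> {v \<in> verts G. (u, v) \<in> arcs G} = insert w (S \<union> T - {u})"
    "{v \<in> verts G. (w, v) \<in> arcs G} = T"
proof -
  have bulk: "{1..r} \<union> {r + 1..n} = {1..n}" "{r + 1..n} \<union> {1..r} = {1..n}"
    by (auto simp: n_def)
  have verts: "verts G = insert (n + 1) (insert (n + 2) {1..n})"
    by (auto simp: G_def fuzzy_ball_def n_def)
  note nbrs = fuzzy_ball_neighbours[where r = r and s = s and l = l and q = q, folded n_def G_def]
  from assms consider "p = n + 1" | "p = n + 2"
    by (auto simp: off_bulk_def)
  then show thesis
  proof cases
    case 1
    show ?thesis
    proof (rule that[of "n + 2" "{1..r}" "{r + 1..n}"])
      show "verts G = insert p (insert (n + 2) ({1..r} \<union> {r + 1..n}))"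
        unfolding verts bulk 1 by blast
    qed (simp_all only: bulk nbrs 1 atLeastAtMost_iff, auto simp: n_def)
  next
    case 2
    show ?thesis
    proof (rule that[of "n + 1" "{r + 1..n}" "{1..r}"])
      show "verts G = insert p (insert (n + 1) ({r + 1..n} \<union> {1..r}))"
        unfolding verts bulk 2 by blast
    qed (simp_all only: bulk nbrs 2 atLeastAtMost_iff, auto simp: n_def)
  qed
qed

text \<open>Write A for n x + 1, \<sigma> for the sum of f over the bulk; e is the degree of the
  off-bulk vertex \<open>w\<close> without lead. The bulk equations give A f = \<sigma> on
  \<open>S\<close> and A f = \<sigma> + f w on \<open>T\<close>. Summing them and inserting the
  equation at \<open>w\<close> gives \<sigma> = (A x - 1) f w and (A - n) \<sigma> = e f w, whence
  the cubic.\<close>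

lemma phi_D_hat_fuzzy_ball_eq_0_iff:
  fixes r s p :: nat and l \<theta> :: real
  defines "n \<equiv> r + s" and "x \<equiv> cos \<theta>" and "e \<equiv> (if p = r + s + 1 then s else r)"
  assumes "r \<ge> 1" "s \<ge> 1" "l > 0" "sin \<theta> \<noteq> 0" "p \<in> off_bulk n" and nx: "n * x + 1 \<noteq> 0"
  shows "phi_D_hat (attach_lead (fuzzy_ball r s l q) p q0) (complex_of_real ((\<theta> / l)\<^sup>2)) = 0 \<longleftrightarrow>
    (n * x + 1 - n) * ((n * x + 1) * x - 1) = e"
proof -
  define F where "F = fuzzy_ball r s l q"
  define G where "G = (attach_lead F p q0)\<lparr>pot := (\<lambda>_ _. 0)\<rparr>"
  have G: "verts G = verts F" "arcs G = arcs F" "len G = l" "pot G = (\<lambda>_ _. 0)" "lead_verts G = {p}"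
    by (simp_all add: G_def F_def attach_lead_def fuzzy_ball_def metric_graph.defs lead_graph.defs)
  obtain w S T where V: "verts F = insert p (insert w (S \<union> T))" "p \<noteq> w" "p \<notin> S \<union> T" "w \<notin> S \<union> T"
    and fin: "finite S" "finite T" "S \<inter> T = {}"
    and T: "card T = e" and S: "card S = (if p = n + 1 then r else s)"
    and nbr: "\<And>u. u \<in> S \<Longrightarrow> {v \<in> verts F. (u, v) \<in> arcs F} = insert p (S \<union> T - {u})"
      "\<And>u. u \<in> T \<Longrightarrow> {v \<in> verts F. (u, v) \<in> arcs F} = insert w (S \<union> T - {u})"
      "{v \<in> verts F. (w, v) \<in> arcs F} = T"
    using fuzzy_ball_neighbours_off_bulk[of p r s l q thesis] \<open>p \<in> off_bulk n\<close>
    unfolding F_def n_def e_def by blast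
  have cards: "card S + card T = n" "card S > 0" "card T > 0"
    using \<open>r \<ge> 1\<close> \<open>s \<ge> 1\<close> by (auto simp: S T n_def e_def)
  define X where "X = complex_of_real x"
  \<comment> \<open>Every bulk vertex has degree n. Adding \<open>f u\<close> to both sides of its
    equation completes the neighbour sum to the whole bulk and changes the factor \<open>n X\<close>
    to \<open>A\<close>.\<close>
  define A where "A = of_nat n * X + 1"
  have "A = complex_of_real (n * x + 1)"
    by (simp add: A_def X_def)
  then have "A \<noteq> 0"
    using nx by (metis of_real_eq_0_iff)
  have sum_nbr: "(\<Sum>v\<in>insert a (S \<union> T - {u}). f v) = of_nat (card (insert a (S \<union> T - {u}))) * X * f u \<longleftrightarrow>
      sum f S + sum f T + f a = A * f u"
    if "u \<in> S \<union> T" "a \<notin> S \<union> T" for f :: "nat \<Rightarrow> complex" and u a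
  proof -
    have "card (S \<union> T) = n"
      using cards fin by (simp add: card_Un_disjoint)
    moreover have "card (S \<union> T) > 0"
      using that fin by (auto simp: card_gt_0_iff)
    ultimately have "card (insert a (S \<union> T - {u})) = n"
      using that fin by simp
    moreover have "sum f (S \<union> T - {u}) = sum f S + sum f T - f u"
      using that fin by (simp add: sum_diff1 sum.union_disjoint)
    ultimately have "(\<Sum>v\<in>insert a (S \<union> T - {u}). f v) = sum f S + sum f T - f u + f a"
      and "of_nat (card (insert a (S \<union> T - {u}))) = (of_nat n :: complex)"
      using that fin by simp_all
    then show ?thesis
      by (simp only: A_def) (auto simp: algebra_simps)
  qed
  have vertex_eqs: "(\<exists>u\<in>verts G. f u \<noteq> 0) \<and> (\<forall>u\<in>verts G \<inter> lead_verts G. f u = 0) \<and>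
      (\<forall>u\<in>verts G - lead_verts G.
        (\<Sum>w | w \<in> verts G \<and> (u, w) \<in> arcs G. f w) =
        of_nat (card {w \<in> verts G. (u, w) \<in> arcs G}) * complex_of_real (cos \<theta>) * f u) \<longleftrightarrow>
    (\<exists>u\<in>insert w (S \<union> T). f u \<noteq> 0) \<and> f p = 0 \<and>
      (\<forall>u\<in>S. sum f S + sum f T = A * f u) \<and>
      (\<forall>u\<in>T. sum f S + sum f T + f w = A * f u) \<and> sum f T = of_nat e * X * f w"
    (is "?lhs \<longleftrightarrow> ?rhs") for f :: "nat \<Rightarrow> complex"
  proof -
    let ?K = "\<lambda>u. (\<Sum>w | w \<in> verts F \<and> (u, w) \<in> arcs F. f w) =
      of_nat (card {w \<in> verts F. (u, w) \<in> arcs F}) * X * f u"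
    have *: "verts G - lead_verts G = insert w (S \<union> T)" "verts G \<inter> lead_verts G = {p}"
      "verts G = insert p (insert w (S \<union> T))"
      using V by (auto simp: G)
    have "?lhs \<longleftrightarrow> (\<exists>u\<in>insert p (insert w (S \<union> T)). f u \<noteq> 0) \<and> f p = 0 \<and> (\<forall>u\<in>insert w (S \<union> T). ?K u)"
      unfolding *(1,2) unfolding *(3)[symmetric] unfolding G X_def x_def by simp
    also have "\<dots> \<longleftrightarrow> (\<exists>u\<in>insert w (S \<union> T). f u \<noteq> 0) \<and> f p = 0 \<and>
        (\<forall>u\<in>S. ?K u) \<and> (\<forall>u\<in>T. ?K u) \<and> ?K w"
      by auto
    also have "(\<forall>u\<in>S. ?K u) \<longleftrightarrow> (\<forall>u\<in>S. sum f S + sum f T + f p = A * f u)"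
      using V(2-) by (intro ball_cong refl) (simp add: nbr sum_nbr del: sum.insert card_insert_disjoint)
    also have "(\<forall>u\<in>T. ?K u) \<longleftrightarrow> (\<forall>u\<in>T. sum f S + sum f T + f w = A * f u)"
      using V(2-) by (intro ball_cong refl) (simp add: nbr sum_nbr del: sum.insert card_insert_disjoint)
    also have "?K w \<longleftrightarrow> sum f T = of_nat e * X * f w"
      by (simp add: nbr T)
    finally show ?thesis by auto
  qed
  have "phi_D_hat (attach_lead F p q0) (complex_of_real ((\<theta> / l)\<^sup>2)) = 0 \<longleftrightarrow>
      phi_D G (complex_of_real ((\<theta> / len G)\<^sup>2)) = 0"
    by (simp add: phi_D_hat_def G_def[symmetric] G)
  also have "\<dots> \<longleftrightarrow>
    (\<exists>f :: nat \<Rightarrow> complex. (\<exists>u\<in>verts G. f u \<noteq> 0) \<and> (\<forall>u\<in>verts G \<inter> lead_verts G. f u = 0) \<and>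
      (\<forall>u\<in>verts G - lead_verts G.
        (\<Sum>w | w \<in> verts G \<and> (u, w) \<in> arcs G. f w) =
        of_nat (card {w \<in> verts G. (u, w) \<in> arcs G}) * complex_of_real (cos \<theta>) * f u))"
  proof (rule phi_D_zero_potential_eq_0_iff)
    show "finite (verts G)" "arcs G \<subseteq> verts G \<times> verts G"
      "\<And>u v. (u, v) \<in> arcs G \<Longrightarrow> (v, u) \<in> arcs G" "\<And>u. (u, u) \<notin> arcs G"
      by (auto simp: G F_def fuzzy_ball_def fuzzy_ball_edges_def)
    show "\<exists>v. (u, v) \<in> arcs G" if "u \<in> verts G" for u
    proof -
      \<comment> \<open>Vertex 1 is joined to \<open>n + 1\<close> since \<open>r \<ge> 1\<close>,
        and \<open>n + 2\<close> to \<open>n\<close> since \<open>s \<ge> 1\<close>; all other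
        vertices are joined to 1.\<close>
      have "(u, if u = 1 then n + 1 else if u = n + 2 then n else 1) \<in> arcs G"
        using that \<open>r \<ge> 1\<close> \<open>s \<ge> 1\<close>
        by (auto simp: G F_def fuzzy_ball_def fuzzy_ball_edges_def n_def)
      then show ?thesis by blast
    qed
  qed (use G \<open>l > 0\<close> \<open>sin \<theta> \<noteq> 0\<close> in auto)
  also have "\<dots> \<longleftrightarrow> (\<exists>f. (\<exists>u\<in>insert w (S \<union> T). f u \<noteq> 0) \<and> f p = 0 \<and>
      (\<forall>u\<in>S. sum f S + sum f T = A * f u) \<and>
      (\<forall>u\<in>T. sum f S + sum f T + f w = A * f u) \<and> sum f T = of_nat e * X * f w)"
    unfolding vertex_eqs ..
  also have "\<dots> \<longleftrightarrow> (A - of_nat n) * (A * X - 1) = of_nat e"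
  proof
    assume "\<exists>f. (\<exists>u\<in>insert w (S \<union> T). f u \<noteq> 0) \<and> f p = 0 \<and>
      (\<forall>u\<in>S. sum f S + sum f T = A * f u) \<and>
      (\<forall>u\<in>T. sum f S + sum f T + f w = A * f u) \<and> sum f T = of_nat e * X * f w"
    then obtain f where f: "\<exists>u\<in>insert w (S \<union> T). f u \<noteq> 0"
      and fS: "\<And>u. u \<in> S \<Longrightarrow> A * f u = sum f S + sum f T"
      and fT: "\<And>u. u \<in> T \<Longrightarrow> A * f u = sum f S + sum f T + f w"
      and fw: "sum f T = of_nat e * X * f w"
      by metis
    define \<sigma> where "\<sigma> = sum f S + sum f T"
    have AS: "A * sum f S = of_nat (card S) * \<sigma>" and AT: "A * sum f T = of_nat e * (\<sigma> + f w)"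
      unfolding sum_distrib_left by (simp_all add: fS fT \<sigma>_def T)
    have "of_nat e \<noteq> (0 :: complex)"
      using cards T by simp
    moreover have "of_nat e * (A * X * f w) = of_nat e * (\<sigma> + f w)"
      using AT by (simp add: fw mult_ac)
    ultimately have "A * X * f w = \<sigma> + f w" by simp
    then have \<sigma>: "\<sigma> = (A * X - 1) * f w"
      by (simp add: algebra_simps)
    have "A * \<sigma> = of_nat (card S) * \<sigma> + of_nat e * (\<sigma> + f w)"
      using AS AT by (simp add: \<sigma>_def distrib_left)
    also have "\<dots> = of_nat n * \<sigma> + of_nat e * f w"
      by (simp add: T algebra_simps flip: cards(1))
    finally have "((A - of_nat n) * (A * X - 1) - of_nat e) * f w = 0"
      by (simp add: \<sigma> algebra_simps)
    \<comment> \<open>If \<open>f w\<close> were 0, then \<sigma> would be 0 and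
      \<open>A * f u = 0\<close> on the whole bulk, so \<open>f\<close> would vanish.\<close>
    moreover have "f w \<noteq> 0"
    proof
      assume "f w = 0"
      then have "\<sigma> = 0" by (simp add: \<sigma>)
      with f fS fT \<open>f w = 0\<close> \<open>A \<noteq> 0\<close> show False
        by (auto simp: \<sigma>_def)
    qed
    ultimately show "(A - of_nat n) * (A * X - 1) = of_nat e" by simp
  next
    assume eq: "(A - of_nat n) * (A * X - 1) = of_nat e"
    \<comment> \<open>Normalizing \<open>f w\<close> to \<open>A\<close> forces \<sigma> to be
      \<open>A * (A * X - 1)\<close>, and division by \<open>A\<close> in the bulk equations gives
      the values on \<open>S\<close> and \<open>T\<close>.\<close>
    define f where "f u = (if u = p then 0 else if u = w then A else if u \<in> S then A * X - 1 else A * X)" for u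
    have fS: "f u = A * X - 1" if "u \<in> S" for u
      using that V by (auto simp: f_def)
    have fT: "f u = A * X" if "u \<in> T" for u
      using that V fin by (auto simp: f_def)
    have fpw: "f p = 0" "f w = A"
      using V by (auto simp: f_def)
    have sums: "sum f S = of_nat (card S) * (A * X - 1)" "sum f T = of_nat e * (A * X)"
      by (simp_all add: fS fT T)
    have "of_nat (card S) + of_nat e = (of_nat n :: complex)"
      using cards(1) T by (metis of_nat_add)
    then have S_eq: "of_nat (card S) = (of_nat n - of_nat e :: complex)"
      by (simp add: algebra_simps)
    \<comment> \<open>The cubic equation enters here: it says that the prescribed bulk values have
      the bulk sum from which they were derived.\<close>
    have "sum f S + sum f T = A * (A * X - 1)"
      unfolding sums S_eq using eq[symmetric] by (simp add: algebra_simps)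
    then have "\<forall>u\<in>S. sum f S + sum f T = A * f u"
      and "\<forall>u\<in>T. sum f S + sum f T + f w = A * f u"
      by (simp_all add: fS fT fpw algebra_simps)
    moreover have "sum f T = of_nat e * X * f w"
      by (simp add: sums fpw)
    ultimately show "\<exists>f. (\<exists>u\<in>insert w (S \<union> T). f u \<noteq> 0) \<and> f p = 0 \<and>
      (\<forall>u\<in>S. sum f S + sum f T = A * f u) \<and>
      (\<forall>u\<in>T. sum f S + sum f T + f w = A * f u) \<and> sum f T = of_nat e * X * f w"
      using fpw \<open>A \<noteq> 0\<close> by blast
  qed
  also have "\<dots> \<longleftrightarrow> complex_of_real ((n * x + 1 - n) * ((n * x + 1) * x - 1)) = complex_of_real e"
    by (simp add: A_def X_def)
  finally show ?thesis
    by (simp only: of_real_eq_iff F_def)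
qed

section \<open>A zero that separates two fuzzy balls\<close>

theorem theorem6p1:
  fixes n r1 s1 r2 s2 w1 w2 :: nat
    and l :: real
    and q1 q2 :: "nat \<times> nat \<Rightarrow> real \<Rightarrow> real"
  assumes "n \<ge> 4" and "l > 0"
    and "r1 \<ge> 1" and "s1 \<ge> 1" and "r1 + s1 = n"
    and "r2 \<ge> 1" and "s2 \<ge> 1" and "r2 + s2 = n"
    and "r1 \<noteq> r2"
    and "\<And>e. e \<in> fuzzy_ball_edges r1 s1 \<Longrightarrow> L2_potential l (q1 e)"
    and "\<And>e. e \<in> fuzzy_ball_edges r2 s2 \<Longrightarrow> L2_potential l (q2 e)"
    and "w1 \<in> off_bulk n" and "w2 \<in> off_bulk n"
    and "w1 \<noteq> w2 \<Longrightarrow> r1 \<noteq> s2"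
  shows "\<not> equal_up_to_constant
           (phi_D_hat (attach_lead (fuzzy_ball r1 s1 l q1) w1 (\<lambda>_. 0)))
           (phi_D_hat (attach_lead (fuzzy_ball r2 s2 l q2) w2 (\<lambda>_. 0)))"
proof
  assume "equal_up_to_constant
           (phi_D_hat (attach_lead (fuzzy_ball r1 s1 l q1) w1 (\<lambda>_. 0)))
           (phi_D_hat (attach_lead (fuzzy_ball r2 s2 l q2) w2 (\<lambda>_. 0)))"
  then have same_zeros: "phi_D_hat (attach_lead (fuzzy_ball r1 s1 l q1) w1 (\<lambda>_. 0)) z = 0 \<longleftrightarrow>
      phi_D_hat (attach_lead (fuzzy_ball r2 s2 l q2) w2 (\<lambda>_. 0)) z = 0" for z
    by (auto simp: equal_up_to_constant_def)
  define e1 where "e1 = (if w1 = r1 + s1 + 1 then s1 else r1)"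
  define e2 where "e2 = (if w2 = r2 + s2 + 1 then s2 else r2)"
  define g where "g = (\<lambda>x::real. (n * x + 1 - n) * ((n * x + 1) * x - 1))"
  \<comment> \<open>If the leads sit at equally numbered vertices, \<open>r1 \<noteq> r2\<close>
    decides; otherwise \<open>e1 = e2\<close> would mean \<open>r1 = s2\<close>, the excluded case
    of isomorphic lead graphs.\<close>
  have "e1 \<noteq> e2"
    using assms unfolding e1_def e2_def off_bulk_def by auto
  have e1: "1 \<le> e1" "e1 < n"
    using assms by (auto simp: e1_def)
  \<comment> \<open>The values \<open>g (-1) \<le> 0\<close> and \<open>g 1 = n\<close> enclose
    \<open>e1\<close> strictly, so the intermediate value theorem gives a root strictly inside the
    interval, as \<open>sin \<theta> \<noteq> 0\<close> requires for
    \<open>\<theta> = arccos x\<close>.\<close>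
  have "g (-1) < e1"
  proof -
    have "g (-1) = - ((2 * real n - 1) * (real n - 2))"
      by (simp add: g_def algebra_simps)
    moreover have "(2 * real n - 1) * (real n - 2) \<ge> 0"
      using \<open>n \<ge> 4\<close> by (intro mult_nonneg_nonneg) auto
    ultimately show ?thesis using e1 by linarith
  qed
  moreover have "e1 < g 1"
    using e1 by (simp add: g_def)
  moreover have "continuous_on {-1..1} g"
    unfolding g_def by (intro continuous_intros)
  ultimately obtain x where x: "-1 \<le> x" "x \<le> 1" "g x = e1"
    using IVT'[of g "-1" "real e1" 1] by auto
  with \<open>g (-1) < e1\<close> \<open>e1 < g 1\<close> have "-1 < x" "x < 1"
    by (metis less_irrefl order_le_less)+
  define \<theta> where "\<theta> = arccos x"
  have cos: "cos \<theta> = x"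
    using x by (simp add: \<theta>_def)
  have sin: "sin \<theta> \<noteq> 0"
    using \<open>-1 < x\<close> \<open>x < 1\<close> by (simp add: \<theta>_def sin_arccos_nonzero)
  \<comment> \<open>At \<open>x = -1/n\<close> the value of \<open>g\<close> is \<open>n\<close>,
    while \<open>e1 < n\<close>.\<close>
  have nx: "n * x + 1 \<noteq> 0"
  proof
    assume "n * x + 1 = 0"
    then have "g x = n" by (simp add: g_def)
    with x e1 show False by simp
  qed
  \<comment> \<open>Since \<open>g\<close> depends on \<open>n\<close> only, it serves both graphs:
    at this point the first function vanishes, and the second would vanish only if
    \<open>g x\<close> were also \<open>e2\<close>.\<close>
  have "phi_D_hat (attach_lead (fuzzy_ball r1 s1 l q1) w1 (\<lambda>_. 0)) (complex_of_real ((\<theta> / l)\<^sup>2)) = 0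
      \<longleftrightarrow> g x = e1"
    using phi_D_hat_fuzzy_ball_eq_0_iff[of r1 s1 l \<theta> w1 q1 "\<lambda>_. 0"] assms(1-8,12) sin nx
    by (simp add: cos g_def e1_def)
  moreover have "phi_D_hat (attach_lead (fuzzy_ball r2 s2 l q2) w2 (\<lambda>_. 0)) (complex_of_real ((\<theta> / l)\<^sup>2)) = 0
      \<longleftrightarrow> g x = e2"
    using phi_D_hat_fuzzy_ball_eq_0_iff[of r2 s2 l \<theta> w2 q2 "\<lambda>_. 0"] assms(1-8,13) sin nx
    by (simp add: cos g_def e2_def)
  ultimately show False
    using same_zeros x \<open>e1 \<noteq> e2\<close> by simp
qed

end
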